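(* Assume the Continuum Hypothesis. If $\mathcal{I}$ is a $\sigma$-ideal on $\mathbb{R}$ with $cf(\mathcal{I})\leq\mathfrak{c}$, then there is a weak selection $f$ on $\mathbb{R}$ such that $\mathcal{N}_f=\mathcal{I}$.
   Context: A $\sigma$-ideal on $\mathbb{R}$ is a family of subsets of $\mathbb{R}$ closed under subsets and countable unions and containing all countable subsets of $\mathbb{R}$ (the improper ideal $\mathcal{P}(\mathbb{R})$ is allowed). The cofinality $cf(\mathcal{I})$ of an ideal $\mathcal{I}$ is the least cardinality of a subset $\mathcal{B}\subseteq\mathcal{I}$ such that for every $I\in\mathcal{I}$ there is $B\in\mathcal{B}$ with $I\subseteq B$. $\mathfrak{c}$ is the cardinality of $\mathbb{R}$. A weak selection on $\mathbb{R}$ is a function $f:[\mathbb{R}]^2\to\mathbb{R}$ with $f(F)\in F$ for every two-element set $F\subseteq\mathbb{R}$. For distinct $x,y$ write $x<_f y$ if $f(\{x,y\})=x$, and $x\leq_f y$ if $x<_f y$ or $x=y$. For $r,s\in\mathbb{R}$, $(r,s]_f=\{x\in\mathbb{R}: r<_f x\leq_f s\}$ (it is not required that $r<_f s$). For $A\subseteq\mathbb{R}$, $\lambda_f(A)=\inf\{\sum_{n\in\mathbb{N}}|s_n-r_n| : A\subseteq\bigcup_{n\in\mathbb{N}}(r_n,s_n]_f\}$ if $A$ can be covered by countably many intervals $(r,s]_f$, and $\lambda_f(A)=+\infty$ otherwise. $\mathcal{N}_f=\{A\subseteq\mathbb{R}:\lambda_f(A)=0\}$. *)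

theory Defs
  imports Complex_Main "HOL-Library.Extended_Nonnegative_Real"
begin

unbundle cardinal_syntax

definition continuum_hypothesis :: bool where
  "continuum_hypothesis \<longleftrightarrow> |UNIV :: real set| =o cardSuc natLeq"

definition sigma_ideal :: "real set set \<Rightarrow> bool" where
  "sigma_ideal I \<longleftrightarrow>
     (\<forall>A\<in>I. \<forall>B. B \<subseteq> A \<longrightarrow> B \<in> I) \<and>
     (\<forall>\<A>. countable \<A> \<and> \<A> \<subseteq> I \<longrightarrow> \<Union>\<A> \<in> I) \<and>
     (\<forall>A. countable A \<longrightarrow> A \<in> I)"

definition cofinal_subfamily :: "'a set set \<Rightarrow> 'a set set \<Rightarrow> bool" where
  "cofinal_subfamily \<B> I \<longleftrightarrow> \<B> \<subseteq> I \<and> (\<forall>A\<in>I. \<exists>B\<in>\<B>. A \<subseteq> B)"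

text \<open>The least cardinality of a cofinal subfamily, as a cardinal in the sense of
  BNF_Cardinal_Order_Relation, hence determined up to \<open>=o\<close>. A subfamily of least cardinality
  always exists, see \<open>least_cofinal_subfamily_exists\<close> below.\<close>

definition cofinality :: "'a set set \<Rightarrow> 'a set rel" where
  "cofinality I = |SOME \<B>. cofinal_subfamily \<B> I \<and>
      (\<forall>\<C>. cofinal_subfamily \<C> I \<longrightarrow> |\<B>| \<le>o |\<C>| )|"

lemma least_cofinal_subfamily_exists:
  "\<exists>\<B>. cofinal_subfamily \<B> I \<and> (\<forall>\<C>. cofinal_subfamily \<C> I \<longrightarrow> |\<B>| \<le>o |\<C>| )"
proof -
  let ?R = "card_of ` {\<B>. cofinal_subfamily \<B> I}"
  have "cofinal_subfamily I I"
    by (auto simp: cofinal_subfamily_def)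
  then have "?R \<noteq> {}" by blast
  moreover have "\<forall>r\<in>?R. Card_order r"
    by (auto intro: card_of_Card_order)
  ultimately have "\<exists>r\<in>?R. \<forall>r'\<in>?R. r \<le>o r'"
    by (intro exists_minim_Card_order)
  then show ?thesis by blast
qed

lemma cofinality_least:
  shows "\<exists>\<B>. cofinal_subfamily \<B> I \<and> cofinality I = |\<B>|"
    and "cofinal_subfamily \<C> I \<Longrightarrow> cofinality I \<le>o |\<C>|"
  using someI_ex[OF least_cofinal_subfamily_exists[of I]]
  unfolding cofinality_def by blast+

text \<open>Only the values of \<open>f\<close> on two-element sets matter.\<close>

definition weak_selection :: "(real set \<Rightarrow> real) \<Rightarrow> bool" where
  "weak_selection f \<longleftrightarrow> (\<forall>F. card F = 2 \<longrightarrow> f F \<in> F)"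

definition sel_less :: "(real set \<Rightarrow> real) \<Rightarrow> real \<Rightarrow> real \<Rightarrow> bool" where
  "sel_less f x y \<longleftrightarrow> x \<noteq> y \<and> f {x, y} = x"

definition sel_le :: "(real set \<Rightarrow> real) \<Rightarrow> real \<Rightarrow> real \<Rightarrow> bool" where
  "sel_le f x y \<longleftrightarrow> sel_less f x y \<or> x = y"

definition sel_interval :: "(real set \<Rightarrow> real) \<Rightarrow> real \<Rightarrow> real \<Rightarrow> real set" where
  "sel_interval f r s = {x. sel_less f r x \<and> sel_le f x s}"

text \<open>If \<open>A\<close> has no countable cover, this is the infimum of the empty set in
  \<^typ>\<open>ennreal\<close>, which is \<open>\<infinity>\<close>. A divergent series also contributes \<open>\<infinity>\<close>.\<close>

definition sel_outer_measure :: "(real set \<Rightarrow> real) \<Rightarrow> real set \<Rightarrow> ennreal" where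
  "sel_outer_measure f A =
     Inf {(\<Sum>n. ennreal \<bar>s n - r n\<bar>) | r s :: nat \<Rightarrow> real.
            A \<subseteq> (\<Union>n. sel_interval f (r n) (s n))}"

definition sel_null_sets :: "(real set \<Rightarrow> real) \<Rightarrow> real set set" where
  "sel_null_sets f = {A. sel_outer_measure f A = 0}"

end

theory Submission
  imports Defs "HOL-Library.Countable_Set_Type" "HOL-Analysis.Continuum_Not_Denumerable"
begin

text \<open>
  A weak selection is a tournament on \<open>\<real>\<close>, and under the Continuum Hypothesis one can be written
  down that codes any given family \<open>(B y)\<close> of sets from \<open>I\<close> indexed by the irrationals. Let \<open>\<prec>\<close>
  be a linear order of \<open>\<real>\<close> with countable initial segments. Rationals are compared as usual
  and lie below all irrationals; for irrationals \<open>y \<prec> x\<close>, the later point \<open>x\<close> is put below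
  \<open>y\<close> if \<open>x \<in> B y\<close> and above \<open>y\<close> otherwise.

  Members of \<open>I\<close> become null: all but countably many points of \<open>B y\<close> lie in the interval
  \<open>(q, y]\<close> for \<^emph>\<open>every\<close> rational \<open>q\<close>, so one arbitrarily short interval takes care of them; and a
  single point \<open>x\<close> lies in \<open>(q, x]\<close> for every rational \<open>q < x\<close>, so the countable rest is null as
  well (\<open>subset_of_coded_set_null\<close>).

  Sets outside \<open>I\<close> have no countable cover at all: let \<open>D\<close> be the set of right endpoints of
  countably many intervals. A set \<open>A \<notin> I\<close> contains an irrational \<open>a\<close> that comes after all of
  \<open>D\<close> and lies in no \<open>B d\<close> with \<open>d \<in> D\<close>, because what these conditions exclude belongs to \<open>I\<close>.
  Then \<open>a\<close> is above all of \<open>D\<close> in the tournament, and no interval with right endpoint in \<open>D\<close>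
  contains \<open>a\<close> (\<open>non_null_outside_ideal\<close>).
  Applied to a cofinal family \<open>B\<close>, the two facts give the theorem.
\<close>

lemma weak_selection_of_tournament:
  fixes T :: "real \<Rightarrow> real \<Rightarrow> bool"
  assumes T: "\<And>x y. x \<noteq> y \<Longrightarrow> T x y \<longleftrightarrow> \<not> T y x"
  shows "\<exists>f. weak_selection f \<and> (\<forall>x y. sel_less f x y \<longleftrightarrow> x \<noteq> y \<and> T x y)"
proof -
  define f where "f F = (SOME x. x \<in> F \<and> (\<exists>y\<in>F. x \<noteq> y \<and> T x y))" for F
  have f_eq: "f {x, y} = x" if "x \<noteq> y" "T x y" for x y
    unfolding f_def by (rule some_equality) (use that T[of x y] in auto)
  have less: "sel_less f x y \<longleftrightarrow> x \<noteq> y \<and> T x y" for x y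
    using f_eq[of x y] f_eq[of y x] T[of x y]
    by (auto simp: sel_less_def insert_commute)
  have "f F \<in> F" if F: "card F = 2" for F
  proof -
    obtain x y where "F = {x, y}" "x \<noteq> y"
      using F by (auto simp: card_2_iff)
    then show ?thesis
      using f_eq[of x y] f_eq[of y x] T[of x y] by (auto simp: insert_commute)
  qed
  then have "weak_selection f"
    by (simp add: weak_selection_def)
  with less show ?thesis
    by blast
qed

lemma sel_null_setI:
  assumes "\<And>e. e > 0 \<Longrightarrow> \<exists>r s. A \<subseteq> (\<Union>n. sel_interval f (r n) (s n)) \<and>
                                (\<Sum>n. ennreal \<bar>s n - r n\<bar>) \<le> ennreal e"
  shows "A \<in> sel_null_sets f"
proof -
  have "sel_outer_measure f A \<le> 0"
  proof (rule ennreal_le_epsilon)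
    fix e :: real
    assume "0 < e"
    obtain r s where "A \<subseteq> (\<Union>n. sel_interval f (r n) (s n))"
        "(\<Sum>n. ennreal \<bar>s n - r n\<bar>) \<le> ennreal e"
      using assms[OF \<open>0 < e\<close>] by blast
    then show "sel_outer_measure f A \<le> 0 + ennreal e"
      unfolding sel_outer_measure_def by (auto intro: Inf_lower2)
  qed
  then show ?thesis
    by (simp add: sel_null_sets_def)
qed

lemma sel_null_set_has_cover:
  assumes "A \<in> sel_null_sets f"
  obtains r s :: "nat \<Rightarrow> real" where "A \<subseteq> (\<Union>n. sel_interval f (r n) (s n))"
proof -
  have "\<exists>r s :: nat \<Rightarrow> real. A \<subseteq> (\<Union>n. sel_interval f (r n) (s n))"
  proof (rule ccontr)
    assume "\<not> ?thesis"
    then have "sel_outer_measure f A = Inf {}"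
      unfolding sel_outer_measure_def by (intro arg_cong[where f = Inf]) blast
    then show False
      using assms by (simp add: sel_null_sets_def)
  qed
  then show thesis
    using that by blast
qed

text \<open>This is the only use of the Continuum Hypothesis: the initial segments of an initial
  well-order of \<open>\<real>\<close> have fewer than \<open>\<aleph>\<^sub>1\<close> points. The relation obtained is the strict part of
  such a well-order.\<close>

lemma total_relation_with_countable_segments:
  assumes "continuum_hypothesis"
  obtains prec :: "real \<Rightarrow> real \<Rightarrow> bool"
  where "\<And>x y. x \<noteq> y \<Longrightarrow> prec x y \<longleftrightarrow> \<not> prec y x"
    and "\<And>x. countable {y. prec y x}"
proof -
  let ?r = "|UNIV :: real set|"
  have wo: "Well_order ?r" and co: "Card_order ?r" and field: "Field ?r = UNIV"
    by (rule card_of_Well_order card_of_Card_order Field_card_of)+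
  then have total: "total ?r" and antisym: "antisym ?r"
    by (auto simp: well_order_on_def linear_order_on_def partial_order_on_def)
  define prec where "prec x y \<longleftrightarrow> x \<in> underS ?r y" for x y
  have "prec x y \<longleftrightarrow> \<not> prec y x" if "x \<noteq> y" for x y
    using total antisym that
    by (auto simp: prec_def underS_def total_on_def antisym_def)
  moreover have "countable {y. prec y x}" for x
  proof -
    have "|underS ?r x| <o ?r"
      using card_of_underS[OF co] field by simp
    then have "|underS ?r x| <o cardSuc natLeq"
      using assms ordLess_ordIso_trans unfolding continuum_hypothesis_def by blast
    then have "|underS ?r x| \<le>o natLeq"
      by (simp only: cardSuc_ordLeq_ordLess[OF natLeq_Card_order card_of_Card_order])
    then show ?thesis
      by (simp add: prec_def countable_card_le_natLeq)
  qed
  ultimately show thesis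
    by (rule that)
qed

text \<open>Only irrational indices can be used for coding, since every rational is to lie below every
  irrational. They suffice because removing the countable set \<open>\<rat>\<close> leaves a set of cardinality
  continuum.\<close>

lemma cofinal_family_indexed_by_irrationals:
  assumes "sigma_ideal I" and cf: "cofinality I \<le>o |UNIV :: real set|"
  obtains B :: "real \<Rightarrow> real set"
  where "\<And>y. B y \<in> I" and "\<And>A. A \<in> I \<Longrightarrow> \<exists>y. y \<notin> \<rat> \<and> A \<subseteq> B y"
proof -
  obtain \<B> where \<B>: "cofinal_subfamily \<B> I" "cofinality I = |\<B>|"
    using cofinality_least(1) by blast
  have "{} \<in> I"
    using \<open>sigma_ideal I\<close> by (auto simp: sigma_ideal_def)
  then have "\<B> \<noteq> {}"
    using \<B>(1) by (auto simp: cofinal_subfamily_def)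
  have "uncountable (- \<rat> :: real set)"
    using uncountable_minus_countable[OF uncountable_UNIV_real countable_rat]
    by (simp add: Compl_eq_Diff_UNIV)
  then have inf: "infinite (- \<rat> :: real set)"
    using countable_finite by blast
  have "|\<rat> :: real set| \<le>o |UNIV :: nat set|"
    using countable_rat countable_card_of_nat by blast
  also have "|UNIV :: nat set| \<le>o |- \<rat> :: real set|"
    using inf infinite_iff_card_of_nat by blast
  finally have "|- \<rat> \<union> \<rat> :: real set| \<le>o |- \<rat> :: real set|"
    using inf by (intro card_of_Un_ordLeq_infinite_Field)
      (auto simp: Field_card_of card_of_card_order_on intro: card_of_mono1)
  moreover have "- \<rat> \<union> \<rat> = (UNIV :: real set)"
    by auto
  ultimately have "|UNIV :: real set| \<le>o |- \<rat> :: real set|"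
    by simp
  from ordLeq_transitive[OF cf this] have "|\<B>| \<le>o |- \<rat> :: real set|"
    by (simp only: \<B>(2))
  then obtain g where g: "g ` (- \<rat> :: real set) = \<B>"
    by (auto simp flip: card_of_ordLeq2[OF \<open>\<B> \<noteq> {}\<close>])
  \<comment> \<open>At rationals any member of \<open>I\<close> would do as a default.\<close>
  define B where "B y = (if y \<in> \<rat> then {} else g y)" for y
  show thesis
  proof
    show "B y \<in> I" for y
      using g \<B>(1) \<open>{} \<in> I\<close> by (auto simp: B_def cofinal_subfamily_def)
    show "\<exists>y. y \<notin> \<rat> \<and> A \<subseteq> B y" if A: "A \<in> I" for A
    proof -
      obtain C where "C \<in> \<B>" "A \<subseteq> C"
        using A \<B>(1) by (auto simp: cofinal_subfamily_def)
      moreover from this obtain y where "y \<notin> \<rat>" "g y = C"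
        using g by blast
      ultimately show ?thesis
        by (auto simp: B_def)
    qed
  qed
qed

text \<open>For distinct \<open>x\<close> and \<open>y\<close> this means that \<open>x\<close> is below \<open>y\<close>. Of two irrationals, the one
  that comes first under \<open>prec\<close> is the one whose set decides.\<close>

definition coding_tournament ::
  "(real \<Rightarrow> real \<Rightarrow> bool) \<Rightarrow> (real \<Rightarrow> real set) \<Rightarrow> real \<Rightarrow> real \<Rightarrow> bool" where
  "coding_tournament prec B x y \<longleftrightarrow>
     (if x \<in> \<rat> then y \<notin> \<rat> \<or> x < y
      else y \<notin> \<rat> \<and> (if prec x y then y \<notin> B x else x \<in> B y))"

lemma coding_tournament_total_asym:
  assumes "x \<noteq> y" and "prec x y \<longleftrightarrow> \<not> prec y x"
  shows "coding_tournament prec B x y \<longleftrightarrow> \<not> coding_tournament prec B y x"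
  using assms by (auto simp: coding_tournament_def)

text \<open>The points of \<open>A\<close> that are irrational and come after \<open>y\<close> fit into \<open>(q, y]\<close> for any
  rational \<open>q\<close>. The other points are countably many, so they can serve, together with \<open>y\<close>, as
  right endpoints of a cover whose left endpoints are nearby rationals.\<close>

lemma subset_of_coded_set_null:
  assumes segments: "\<And>x. countable {y. prec y x}"
    and less: "\<And>x y. sel_less f x y \<longleftrightarrow> x \<noteq> y \<and> coding_tournament prec B x y"
    and y: "y \<notin> \<rat>" and A: "A \<subseteq> B y"
  shows "A \<in> sel_null_sets f"
proof (rule sel_null_setI)
  fix e :: real
  assume "e > 0"
  define K where "K = insert y (\<rat> \<union> {x. prec x y})"
  define s where "s = from_nat_into K"
  have K: "countable K" "K \<noteq> {}"
    using segments[of y] by (auto simp: K_def countable_rat)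
  then have range_s: "range s = K"
    by (simp add: s_def range_from_nat_into)
  have "\<exists>q\<in>\<rat>. s n - e * (1/2) ^ Suc n < q \<and> q < s n" for n
    by (rule Rats_dense_in_real) (use \<open>e > 0\<close> in simp)
  then obtain r where r: "\<And>n. r n \<in> \<rat>" "\<And>n. s n - e * (1/2) ^ Suc n < r n" "\<And>n. r n < s n"
    by metis
  have "A \<subseteq> (\<Union>n. sel_interval f (r n) (s n))"
  proof
    fix x assume "x \<in> A"
    show "x \<in> (\<Union>n. sel_interval f (r n) (s n))"
    proof (cases "x \<in> K")
      case True
      then obtain n where "x = s n"
        using range_s by blast
      then have "x \<in> sel_interval f (r n) (s n)"
        using r[of n] by (auto simp: sel_interval_def sel_le_def less coding_tournament_def)
      then show ?thesis by blast
    next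
      case False
      then have x: "x \<notin> \<rat>" "x \<noteq> y" "\<not> prec x y"
        by (auto simp: K_def)
      obtain n where "y = s n"
        using range_s K_def by blast
      moreover have "coding_tournament prec B x y"
        using x y A \<open>x \<in> A\<close> by (auto simp: coding_tournament_def)
      ultimately have "x \<in> sel_interval f (r n) (s n)"
        using r(1)[of n] x by (auto simp: sel_interval_def sel_le_def less coding_tournament_def)
      then show ?thesis by blast
    qed
  qed
  moreover have "(\<Sum>n. ennreal \<bar>s n - r n\<bar>) \<le> ennreal e"
  proof -
    have "(\<Sum>n. ennreal \<bar>s n - r n\<bar>) \<le> (\<Sum>n. ennreal (e * (1/2) ^ Suc n))"
    proof (intro suminf_le ennreal_leI)
      show "\<bar>s n - r n\<bar> \<le> e * (1/2) ^ Suc n" for n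
        using r(2,3)[of n] by simp
    qed auto
    also have "(\<lambda>n. e * (1/2) ^ Suc n) sums (e * 1)"
      by (intro sums_mult power_half_series)
    then have "(\<Sum>n. ennreal (e * (1/2) ^ Suc n)) = ennreal e"
      using \<open>e > 0\<close> by (intro suminf_ennreal_eq) auto
    finally show ?thesis .
  qed
  ultimately show "\<exists>r s. A \<subseteq> (\<Union>n. sel_interval f (r n) (s n)) \<and>
      (\<Sum>n. ennreal \<bar>s n - r n\<bar>) \<le> ennreal e"
    by blast
qed

text \<open>The set \<open>E\<close> in the proof depends only on the right endpoints of the cover, and every
  interval with such a right endpoint is contained in \<open>E\<close>. As a countable union of members of \<open>I\<close>,
  it belongs to \<open>I\<close>; so no countable family of intervals, however long, covers a set
  outside \<open>I\<close>.\<close>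

lemma non_null_outside_ideal:
  assumes "sigma_ideal I"
    and segments: "\<And>x. countable {y. prec y x}"
    and less: "\<And>x y. sel_less f x y \<longleftrightarrow> x \<noteq> y \<and> coding_tournament prec B x y"
    and B: "\<And>y. B y \<in> I" and "A \<notin> I"
  shows "A \<notin> sel_null_sets f"
proof
  assume "A \<in> sel_null_sets f"
  then obtain r s :: "nat \<Rightarrow> real" where cover: "A \<subseteq> (\<Union>n. sel_interval f (r n) (s n))"
    by (rule sel_null_set_has_cover)
  \<comment> \<open>\<open>N\<close> takes care of the points that can be at or below some \<open>s n\<close> without
      belonging to \<open>B (s n)\<close>.\<close>
  define N where "N = \<rat> \<union> (\<Union>n. insert (s n) {x. prec x (s n)})"
  define E where "E = \<Union>(insert N (range (\<lambda>n. B (s n))))"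
  have "countable N"
    using segments by (auto simp: N_def countable_rat)
  then have "N \<in> I"
    using \<open>sigma_ideal I\<close> by (auto simp: sigma_ideal_def)
  then have "countable (insert N (range (\<lambda>n. B (s n))))" "insert N (range (\<lambda>n. B (s n))) \<subseteq> I"
    using B by auto
  then have "E \<in> I"
    unfolding E_def using \<open>sigma_ideal I\<close> by (simp only: sigma_ideal_def)
  then have "\<not> A \<subseteq> E"
    using \<open>A \<notin> I\<close> \<open>sigma_ideal I\<close> unfolding sigma_ideal_def by blast
  then obtain a where "a \<in> A" and a: "a \<notin> \<rat>" "\<And>n. a \<noteq> s n"
      "\<And>n. \<not> prec a (s n)" "\<And>n. a \<notin> B (s n)"
    by (auto simp: E_def N_def)
  have "\<not> coding_tournament prec B a (s n)" for n
    using a by (auto simp: coding_tournament_def)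
  then have "a \<notin> sel_interval f (r n) (s n)" for n
    using a(2) by (auto simp: sel_interval_def sel_le_def less)
  then show False
    using cover \<open>a \<in> A\<close> by blast
qed

theorem theorem2p9:
  fixes I :: "real set set"
  assumes "continuum_hypothesis"
    and "sigma_ideal I"
    and "cofinality I \<le>o |UNIV :: real set|"
  shows "\<exists>f. weak_selection f \<and> sel_null_sets f = I"
proof -
  obtain prec :: "real \<Rightarrow> real \<Rightarrow> bool" where prec:
      "\<And>x y. x \<noteq> y \<Longrightarrow> prec x y \<longleftrightarrow> \<not> prec y x" "\<And>x. countable {y. prec y x}"
    by (fact total_relation_with_countable_segments[OF assms(1)])
  obtain B :: "real \<Rightarrow> real set"
    where B: "\<And>y. B y \<in> I" "\<And>A. A \<in> I \<Longrightarrow> \<exists>y. y \<notin> \<rat> \<and> A \<subseteq> B y"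
    by (fact cofinal_family_indexed_by_irrationals[OF assms(2,3)])
  have "coding_tournament prec B x y \<longleftrightarrow> \<not> coding_tournament prec B y x" if "x \<noteq> y" for x y
    using that prec(1)[OF that] by (rule coding_tournament_total_asym)
  then have "\<exists>f. weak_selection f \<and>
      (\<forall>x y. sel_less f x y \<longleftrightarrow> x \<noteq> y \<and> coding_tournament prec B x y)"
    by (rule weak_selection_of_tournament)
  then obtain f where f: "weak_selection f"
      "\<And>x y. sel_less f x y \<longleftrightarrow> x \<noteq> y \<and> coding_tournament prec B x y"
    by (elim exE conjE) simp
  have "A \<in> sel_null_sets f" if A: "A \<in> I" for A
  proof -
    obtain y where "y \<notin> \<rat>" "A \<subseteq> B y"
      using B(2)[OF A] by blast
    then show ?thesis
      by (rule subset_of_coded_set_null[OF prec(2) f(2)])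
  qed
  moreover have "A \<notin> sel_null_sets f" if "A \<notin> I" for A
    by (rule non_null_outside_ideal[OF assms(2) prec(2) f(2) B(1) that])
  ultimately have "sel_null_sets f = I"
    by blast
  then show ?thesis
    using f(1) by blast
qed

end
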